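(* Let $G$ be a finite soluble group and let $K$ be a $2$-maximal subgroup of $G$. If $K$ is not a strictly $2$-maximal subgroup of $G$, then there is a unique maximal subgroup $V$ of $G$ such that $K<V$ and $K$ is not maximal in $V$.
   Context: All groups are finite. A subgroup $M$ of a group $G$ is maximal, written $M\lessdot G$, if $M<G$ (proper) and $M\le H\le G$ implies $H=M$ or $H=G$. For a subgroup $H\le G$, $\mathrm{Max}(G,H)=\{M\lessdot G\mid H\le M\}$ is the set of maximal subgroups of $G$ containing $H$. A subgroup $H$ of $G$ is called $2$-maximal in $G$ if there is $M\in\mathrm{Max}(G,H)$ with $H\lessdot M$. A proper subgroup $H$ of $G$ is called strictly $2$-maximal in $G$ if $H\lessdot M$ for all $M\in \mathrm{Max}(G,H)$. *)

theory Defs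
  imports "HOL-Algebra.Solvable_Groups"
begin

definition maximal_subgroup :: "'a set \<Rightarrow> ('a, 'b) monoid_scheme \<Rightarrow> bool" where
  "maximal_subgroup M G \<longleftrightarrow>
     subgroup M G \<and> M \<noteq> carrier G \<and>
     (\<forall>H. subgroup H G \<longrightarrow> M \<subseteq> H \<longrightarrow> H = M \<or> H = carrier G)"

definition maximal_over :: "('a, 'b) monoid_scheme \<Rightarrow> 'a set \<Rightarrow> 'a set set" where
  "maximal_over G H = {M. maximal_subgroup M G \<and> H \<subseteq> M}"

definition two_maximal :: "'a set \<Rightarrow> ('a, 'b) monoid_scheme \<Rightarrow> bool" where
  "two_maximal H G \<longleftrightarrow>
     subgroup H G \<and>
     (\<exists>M \<in> maximal_over G H. maximal_subgroup H (G\<lparr>carrier := M\<rparr>))"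

text \<open>A maximal subgroup \<open>H\<close> of \<open>G\<close> is never strictly 2-maximal: it lies in
  \<^term>\<open>maximal_over G H\<close> itself, but is not maximal in itself.\<close>

definition strictly_two_maximal :: "'a set \<Rightarrow> ('a, 'b) monoid_scheme \<Rightarrow> bool" where
  "strictly_two_maximal H G \<longleftrightarrow>
     subgroup H G \<and> H \<noteq> carrier G \<and>
     (\<forall>M \<in> maximal_over G H. maximal_subgroup H (G\<lparr>carrier := M\<rparr>))"

end

theory Submission
  imports Defs "HOL-Algebra.SndIsomorphismGrp"
begin

text \<open>
  Let \<open>K\<close> be maximal in the maximal subgroup \<open>M\<close>, and call a maximal subgroup \<open>V\<close> of \<open>G\<close> above \<open>K\<close>
  exceptional if \<open>K\<close> is not maximal in \<open>V\<close>. An exceptional \<open>V\<close> differs from \<open>M\<close>, so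
  \<open>V \<inter> M = K\<close>. The idea is to find a normal subgroup \<open>N\<close>, depending on \<open>M\<close> only, such that every
  exceptional \<open>V\<close> equals \<open>N K\<close>; this gives uniqueness. Existence is the failure of strict
  2-maximality, which provides a \<open>V\<close> properly above \<open>K\<close> because \<open>K < M < G\<close> is not maximal in \<open>G\<close>.

  Take \<open>N\<close> minimal among the normal subgroups of \<open>G\<close> not contained in \<open>M\<close>. Then \<open>G = N M\<close>.
  Solubility makes the derived subgroup \<open>N'\<close> a proper subgroup of \<open>N\<close>, and it is normal in \<open>G\<close>, so
  \<open>N' \<subseteq> M\<close> by minimality. Hence \<open>N\<close> is abelian modulo \<open>N \<inter> M\<close>, and \<open>D = N \<inter> M\<close> is normal in \<open>G\<close>,
  being normalised both by \<open>N\<close> and by \<open>M\<close>.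

  The tool that decides maximality is a lattice isomorphism (lemma
  \<open>maximal_subgroup_iff_normal_product\<close>): if \<open>A\<close> is normal and \<open>G = A V\<close>, then \<open>H \<mapsto> A H\<close> maps the
  subgroups between \<open>A \<inter> V\<close> and \<open>V\<close> onto the subgroups between \<open>A\<close> and \<open>G\<close>. Thus, when
  \<open>A \<inter> V \<subseteq> K \<subseteq> V\<close>, the subgroup \<open>K\<close> is maximal in \<open>V\<close> if and only if \<open>A K\<close> is maximal in \<open>G\<close>.
  For an exceptional \<open>V\<close> this leads to \<open>N \<subseteq> V\<close> in two steps.

  If \<open>D\<close> were not contained in \<open>V\<close>, then \<open>G = D V\<close> and \<open>D K = D (V \<inter> M) = M\<close> is maximal in \<open>G\<close>, so
  \<open>K\<close> would be maximal in \<open>V\<close>. Hence \<open>D \<subseteq> V \<inter> M = K\<close>.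

  If \<open>N\<close> were not contained in \<open>V\<close>, then \<open>G = N V\<close>. As \<open>N' \<subseteq> D \<subseteq> V\<close>, the intersection \<open>N \<inter> V\<close>
  is normal in \<open>G\<close>; it is smaller than \<open>N\<close>, so it lies in \<open>N \<inter> M = D \<subseteq> K\<close>. Now both \<open>M\<close> and \<open>V\<close>
  are supplements of \<open>N\<close> meeting it inside \<open>K\<close>, and the isomorphism applied to \<open>M\<close> and then to \<open>V\<close>
  carries maximality of \<open>K\<close> in \<open>M\<close> to maximality of \<open>N K\<close> in \<open>G\<close> and on to maximality of
  \<open>K\<close> in \<open>V\<close>. Comparing the two intervals above \<open>K\<close> inside \<open>G / N\<close> in this way avoids
  the conjugacy of complements.

  So \<open>N \<subseteq> V\<close>, and then \<open>V = N (M \<inter> V) = N K\<close>.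
\<close>

section \<open>Maximal subgroups and products with a normal subgroup\<close>

context group
begin

lemma maximal_subgroup_in_subgroup_iff:
  assumes "subgroup V G"
  shows "maximal_subgroup K (G\<lparr>carrier := V\<rparr>) \<longleftrightarrow>
    subgroup K G \<and> K \<subset> V \<and>
    (\<forall>H. subgroup H G \<longrightarrow> K \<subseteq> H \<longrightarrow> H \<subseteq> V \<longrightarrow> H = K \<or> H = V)"
proof -
  have "subgroup H (G\<lparr>carrier := V\<rparr>) \<longleftrightarrow> subgroup H G \<and> H \<subseteq> V" for H
    using incl_subgroup[OF assms, of H] subgroup_incl[OF _ assms, of H]
      subgroup.subset[of H "G\<lparr>carrier := V\<rparr>"] by auto
  then show ?thesis
    unfolding maximal_subgroup_def by auto
qed

lemma normal_product_properties:
  assumes "N \<lhd> G" and "subgroup H G"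
  shows "subgroup (N <#> H) G" and "N \<subseteq> N <#> H" and "H \<subseteq> N <#> H"
proof -
  interpret normal N G by fact
  interpret second_isomorphism_grp N G H
    by (intro second_isomorphism_grp.intro second_isomorphism_grp_axioms.intro normal_axioms assms(2))
  show "subgroup (N <#> H) G" "N \<subseteq> N <#> H" "H \<subseteq> N <#> H"
    by (fact normal_set_mult_subgroup H_contained_in_set_mult S_contained_in_set_mult)+
qed

lemma maximal_subgroup_normal_product:
  assumes "maximal_subgroup M G" and "N \<lhd> G" and "\<not> N \<subseteq> M"
  shows "N <#> M = carrier G"
  using assms normal_product_properties[of N M] unfolding maximal_subgroup_def by metis

lemma normal_product_Int_supplement:
  assumes "subgroup N G" and "subgroup V G" and "subgroup H G"
    and "N \<inter> V \<subseteq> H" and "H \<subseteq> V"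
  shows "(N <#> H) \<inter> V = H"
proof
  show "(N <#> H) \<inter> V \<subseteq> H"
  proof
    fix x assume "x \<in> (N <#> H) \<inter> V"
    then obtain n h where nh: "n \<in> N" "h \<in> H" "x = n \<otimes> h" and x: "x \<in> V"
      unfolding set_mult_def by blast
    have "n \<in> carrier G" "h \<in> carrier G"
      using nh assms by (auto dest: subgroup.mem_carrier)
    then have "n = x \<otimes> inv h"
      using nh(3) by (simp add: m_assoc)
    moreover have "x \<otimes> inv h \<in> V"
      using x nh(2) assms(2,5) by (blast intro: subgroup.m_closed subgroup.m_inv_closed)
    ultimately have "n \<in> H"
      using nh(1) assms(4) by auto
    then show "x \<in> H"
      using nh assms(3) by (simp add: subgroup.m_closed)
  qed
  show "H \<subseteq> (N <#> H) \<inter> V"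
  proof
    fix h assume h: "h \<in> H"
    then have "h = \<one> \<otimes> h"
      using assms(3) by (simp add: subgroup.mem_carrier)
    then show "h \<in> (N <#> H) \<inter> V"
      using h subgroup.one_closed[OF assms(1)] assms(5) unfolding set_mult_def by blast
  qed
qed

lemma supplement_Int_normal_product:
  assumes "subgroup N G" and "subgroup V G" and "subgroup L G"
    and "N \<subseteq> L" and "N <#> V = carrier G"
  shows "N <#> (V \<inter> L) = L"
proof
  show "N <#> (V \<inter> L) \<subseteq> L"
    using assms(3,4) by (auto simp: set_mult_def intro: subgroup.m_closed)
  show "L \<subseteq> N <#> (V \<inter> L)"
  proof
    fix x assume x: "x \<in> L"
    then have "x \<in> N <#> V"
      using assms(3,5) by (simp add: subgroup.mem_carrier)
    then obtain n v where nv: "n \<in> N" "v \<in> V" "x = n \<otimes> v"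
      unfolding set_mult_def by blast
    have "n \<in> carrier G" "v \<in> carrier G"
      using nv assms by (auto dest: subgroup.mem_carrier)
    then have "v = inv n \<otimes> x"
      using nv(3) by (simp add: m_assoc[symmetric])
    then have "v \<in> L"
      using x nv(1) assms(3,4) by (auto intro: subgroup.m_closed subgroup.m_inv_closed)
    then show "x \<in> N <#> (V \<inter> L)"
      using nv unfolding set_mult_def by blast
  qed
qed

text \<open>Since \<open>G = N V\<close>, the maps \<open>H \<mapsto> N H\<close> and \<open>L \<mapsto> V \<inter> L\<close> are mutually inverse between the subgroups
  in the interval from \<open>N \<inter> V\<close> to \<open>V\<close> and the subgroups of \<open>G\<close> containing \<open>N\<close>, by the two modular
  laws above. This is the subgroup correspondence behind \<open>V / (N \<inter> V) \<cong> G / N\<close>.\<close>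

lemma maximal_subgroup_iff_normal_product:
  assumes "N \<lhd> G" and "subgroup V G" and "subgroup K G"
    and "N \<inter> V \<subseteq> K" and "K \<subseteq> V" and "N <#> V = carrier G"
  shows "maximal_subgroup K (G\<lparr>carrier := V\<rparr>) \<longleftrightarrow> maximal_subgroup (N <#> K) G"
proof -
  have N: "subgroup N G"
    using assms(1) by (rule normal_imp_subgroup)
  have recover: "(N <#> H) \<inter> V = H" if "subgroup H G" "K \<subseteq> H" "H \<subseteq> V" for H
    using that assms normal_product_Int_supplement[OF N] by (meson subset_trans)
  have NK: "subgroup (N <#> K) G" "N \<subseteq> N <#> K" "K \<subseteq> N <#> K"
    using normal_product_properties assms by auto
  have VG: "V \<subseteq> carrier G"
    using assms(2) by (rule subgroup.subset)
  show ?thesis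
  proof
    assume "maximal_subgroup K (G\<lparr>carrier := V\<rparr>)"
    then have max: "K \<subset> V"
      "\<And>H. \<lbrakk>subgroup H G; K \<subseteq> H; H \<subseteq> V\<rbrakk> \<Longrightarrow> H = K \<or> H = V"
      using maximal_subgroup_in_subgroup_iff[OF assms(2)] by auto
    have "N <#> K \<noteq> carrier G"
      using max(1) recover[OF assms(3) subset_refl assms(5)] VG by auto
    moreover have "L = N <#> K \<or> L = carrier G" if L: "subgroup L G" "N <#> K \<subseteq> L" for L
    proof -
      have "V \<inter> L = K \<or> V \<inter> L = V"
        using L NK assms(2,5) by (intro max(2) subgroups_Inter_pair) auto
      moreover have "N <#> (V \<inter> L) = L"
        using L NK by (intro supplement_Int_normal_product N assms) auto
      ultimately show ?thesis
        using assms(6) by metis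
    qed
    ultimately show "maximal_subgroup (N <#> K) G"
      using NK unfolding maximal_subgroup_def by blast
  next
    assume "maximal_subgroup (N <#> K) G"
    then have max: "N <#> K \<noteq> carrier G"
      "\<And>L. \<lbrakk>subgroup L G; N <#> K \<subseteq> L\<rbrakk> \<Longrightarrow> L = N <#> K \<or> L = carrier G"
      unfolding maximal_subgroup_def by auto
    have "H = K \<or> H = V" if H: "subgroup H G" "K \<subseteq> H" "H \<subseteq> V" for H
    proof -
      have "N <#> H = N <#> K \<or> N <#> H = carrier G"
        using H assms(1) by (intro max(2) normal_product_properties mono_set_mult) auto
      then show ?thesis
        using recover[OF H] recover[OF assms(3) subset_refl assms(5)] VG by auto
    qed
    moreover have "K \<noteq> V"
      using max(1) assms(6) by auto
    ultimately show "maximal_subgroup K (G\<lparr>carrier := V\<rparr>)"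
      using maximal_subgroup_in_subgroup_iff[OF assms(2)] assms(3,5) by blast
  qed
qed

section \<open>Minimal normal supplements in soluble groups\<close>

text \<open>The intersection is normalised by \<open>X\<close> because \<open>N\<close> is normal, and by \<open>N\<close> because a conjugate
  \<open>n z n\<inverse>\<close> differs from \<open>z\<close> by a commutator of elements of \<open>N\<close>; and \<open>N\<close> and \<open>X\<close> together
  exhaust \<open>G\<close>.\<close>

lemma normal_Int_supplement:
  assumes "N \<lhd> G" and "subgroup X G" and "derived G N \<subseteq> X" and "N <#> X = carrier G"
  shows "N \<inter> X \<lhd> G"
proof (rule normal_invI)
  interpret N: normal N G by fact
  show "subgroup (N \<inter> X) G"
    by (intro subgroups_Inter_pair assms(2) N.is_subgroup)
  fix g x assume g: "g \<in> carrier G" and x: "x \<in> N \<inter> X"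
  have "g \<in> N <#> X"
    using g assms(4) by simp
  then obtain n y where ny: "n \<in> N" "y \<in> X" "g = n \<otimes> y"
    unfolding set_mult_def by blast
  have carr: "n \<in> carrier G" "y \<in> carrier G" "x \<in> carrier G"
    using ny x N.mem_carrier subgroup.mem_carrier[OF assms(2)] by auto
  define z where "z = y \<otimes> x \<otimes> inv y"
  have zN: "z \<in> N"
    unfolding z_def using x carr by (simp add: N.inv_op_closed2)
  have zX: "z \<in> X"
    unfolding z_def using x ny(2)
    by (intro subgroup.m_closed[OF assms(2)] subgroup.m_inv_closed[OF assms(2)]) auto
  have zcarr: "z \<in> carrier G"
    using zN by (rule N.mem_carrier)
  have "n \<otimes> z \<otimes> inv n \<otimes> inv z \<in> derived G N"
    unfolding derived_def using ny(1) zN by (intro generate.incl) blast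
  then have "n \<otimes> z \<otimes> inv n \<otimes> inv z \<otimes> z \<in> X"
    using assms(3) subgroup.m_closed[OF assms(2) _ zX] by blast
  moreover have "n \<otimes> z \<otimes> inv n \<otimes> inv z \<otimes> z = g \<otimes> x \<otimes> inv g"
  proof -
    have "n \<otimes> z \<otimes> inv n \<otimes> inv z \<otimes> z = n \<otimes> z \<otimes> inv n"
      using carr zcarr by (simp add: m_assoc)
    then show ?thesis
      using carr by (simp add: z_def ny(3) inv_mult_group m_assoc)
  qed
  moreover have "g \<otimes> x \<otimes> inv g \<in> N"
    using x g by (simp add: N.inv_op_closed2)
  ultimately show "g \<otimes> x \<otimes> inv g \<in> N \<inter> X"
    by simp
qed

lemma derived_psubset_of_solvable:
  assumes "solvable G" and "subgroup N G" and "N \<noteq> {\<one>}"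
  shows "derived G N \<subset> N"
proof -
  obtain k where k: "(derived G ^^ k) N = {\<one>}"
    using solvable_imp_trivial_derived_seq solvable_subgroup assms(1,2) by blast
  have "(derived G ^^ k) N = N" if "derived G N = N"
    using that by (induction k) auto
  then have "derived G N \<noteq> N"
    using k assms(3) by metis
  then show ?thesis
    using derived_incl[OF subset_refl assms(2)] by (simp add: psubset_eq)
qed

lemma minimal_normal_not_subset_exists:
  assumes "finite (carrier G)" and "\<not> carrier G \<subseteq> M"
  obtains N where "N \<lhd> G" and "\<not> N \<subseteq> M" and "\<And>L. \<lbrakk>L \<lhd> G; L \<subset> N\<rbrakk> \<Longrightarrow> L \<subseteq> M"
proof -
  let ?S = "{N. N \<lhd> G \<and> \<not> N \<subseteq> M}"
  have "?S \<subseteq> Pow (carrier G)"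
    using normal_imp_subgroup subgroup.subset by blast
  then have "finite ?S"
    by (rule finite_subset) (simp add: assms(1))
  moreover have "?S \<noteq> {}"
    using assms(2) normal_self by blast
  ultimately obtain N where "N \<in> ?S" "\<And>L. L \<in> ?S \<Longrightarrow> L \<subseteq> N \<Longrightarrow> N = L"
    using finite_has_minimal[of ?S] by blast
  then show ?thesis
    using that by blast
qed

section \<open>Exceptional maximal subgroups\<close>

lemma Int_maximal_subgroups_eq:
  assumes "maximal_subgroup M G" and "maximal_subgroup V G" and "V \<noteq> M" and "K \<subseteq> V"
    and "maximal_subgroup K (G\<lparr>carrier := M\<rparr>)"
  shows "V \<inter> M = K"
proof -
  have M: "subgroup M G" and V: "subgroup V G"
    using assms(1,2) unfolding maximal_subgroup_def by auto
  have "V \<inter> M = K \<or> V \<inter> M = M"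
    using assms(4,5) subgroups_Inter_pair[OF V M] maximal_subgroup_in_subgroup_iff[OF M] by auto
  then show ?thesis
    using assms(1-3) V unfolding maximal_subgroup_def by blast
qed

text \<open>The product \<open>N K\<close> does not mention \<open>V\<close>: this is what makes the exceptional maximal subgroup
  unique. The hypotheses on \<open>N\<close> say that it is a minimal normal supplement of \<open>M\<close>,
  abelian modulo its intersection with \<open>M\<close>.\<close>

lemma exceptional_maximal_subgroup_eq:
  assumes M: "maximal_subgroup M G" and KM: "maximal_subgroup K (G\<lparr>carrier := M\<rparr>)"
    and N: "N \<lhd> G" "\<not> N \<subseteq> M" "derived G N \<subseteq> M"
    and min: "\<And>L. \<lbrakk>L \<lhd> G; L \<subset> N\<rbrakk> \<Longrightarrow> L \<subseteq> M"
    and V: "maximal_subgroup V G" "K \<subseteq> V" "\<not> maximal_subgroup K (G\<lparr>carrier := V\<rparr>)"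
  shows "V = N <#> K"
proof -
  have subM: "subgroup M G" and subV: "subgroup V G"
    using M V(1) unfolding maximal_subgroup_def by auto
  have subN: "subgroup N G"
    using N(1) by (rule normal_imp_subgroup)
  have subK: "subgroup K G" and KsubM: "K \<subseteq> M"
    using KM maximal_subgroup_in_subgroup_iff[OF subM] by auto
  have VM: "V \<inter> M = K"
    using Int_maximal_subgroups_eq[OF M V(1) _ V(2) KM] V(3) KM by auto
  have NM: "N <#> M = carrier G"
    using M N by (intro maximal_subgroup_normal_product)
  have D: "N \<inter> M \<lhd> G"
    using N subM NM by (intro normal_Int_supplement)
  have DK: "N \<inter> M \<subseteq> K"
  proof (rule ccontr)
    assume "\<not> N \<inter> M \<subseteq> K"
    then have "\<not> N \<inter> M \<subseteq> V"
      using VM by auto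
    then have DV: "(N \<inter> M) <#> V = carrier G"
      using D V(1) by (intro maximal_subgroup_normal_product)
    have "(N \<inter> M) <#> K = M"
      using supplement_Int_normal_product[OF normal_imp_subgroup[OF D] subV subM _ DV] VM by simp
    then have "maximal_subgroup K (G\<lparr>carrier := V\<rparr>)"
      using maximal_subgroup_iff_normal_product[OF D subV subK _ V(2) DV] M VM by auto
    then show False
      using V(3) by contradiction
  qed
  have "N \<subseteq> V"
  proof (rule ccontr)
    assume NV': "\<not> N \<subseteq> V"
    then have NV: "N <#> V = carrier G"
      using N V(1) by (intro maximal_subgroup_normal_product)
    have "derived G N \<subseteq> V"
      using derived_incl[OF subset_refl subN] N(3) DK V(2) by blast
    then have "N \<inter> V \<lhd> G"
      using N subV NV by (intro normal_Int_supplement)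
    then have "N \<inter> V \<subseteq> M"
      using NV' by (intro min) auto
    then have NVK: "N \<inter> V \<subseteq> K"
      using DK by blast
    have "maximal_subgroup (N <#> K) G"
      using maximal_subgroup_iff_normal_product[OF N(1) subM subK DK KsubM NM] KM by blast
    then have "maximal_subgroup K (G\<lparr>carrier := V\<rparr>)"
      using maximal_subgroup_iff_normal_product[OF N(1) subV subK NVK V(2) NV] by blast
    then show False
      using V(3) by contradiction
  qed
  then show ?thesis
    using supplement_Int_normal_product[OF subN subM subV _ NM] VM by (simp add: Int_commute)
qed

end

theorem corollary1p2:
  fixes G :: "('a, 'b) monoid_scheme" and K :: "'a set"
  assumes "group G" and "finite (carrier G)" and "solvable G"
    and "two_maximal K G"
    and "\<not> strictly_two_maximal K G"
  shows "\<exists>!V. maximal_subgroup V G \<and> K \<subset> V \<and>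
           \<not> maximal_subgroup K (G\<lparr>carrier := V\<rparr>)"
proof -
  interpret group G by fact
  obtain M where M: "maximal_subgroup M G" and KM: "maximal_subgroup K (G\<lparr>carrier := M\<rparr>)"
    using assms(4) unfolding two_maximal_def maximal_over_def by blast
  have subM: "subgroup M G" and M_proper: "M \<subset> carrier G"
    using M subgroup.subset unfolding maximal_subgroup_def by blast+
  have subK: "subgroup K G" and KM_proper: "K \<subset> M"
    using KM maximal_subgroup_in_subgroup_iff[OF subM] by auto
  obtain V where V: "maximal_subgroup V G" "K \<subseteq> V" "\<not> maximal_subgroup K (G\<lparr>carrier := V\<rparr>)"
    using assms(5) subK KM_proper M_proper
    unfolding strictly_two_maximal_def maximal_over_def by blast
  have "K \<noteq> V"
    using V(1) KM_proper M_proper subM unfolding maximal_subgroup_def by blast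
  obtain N where N: "N \<lhd> G" "\<not> N \<subseteq> M" and min: "\<And>L. \<lbrakk>L \<lhd> G; L \<subset> N\<rbrakk> \<Longrightarrow> L \<subseteq> M"
    using minimal_normal_not_subset_exists[OF assms(2), of M] M_proper by blast
  have "N \<noteq> {\<one>\<^bsub>G\<^esub>}"
    using N(2) subgroup.one_closed[OF subM] by auto
  then have "derived G N \<subseteq> M"
    using min derived_is_normal[OF N(1)]
      derived_psubset_of_solvable[OF assms(3) normal_imp_subgroup[OF N(1)]] by blast
  then have "W = N <#>\<^bsub>G\<^esub> K"
    if "maximal_subgroup W G" "K \<subseteq> W" "\<not> maximal_subgroup K (G\<lparr>carrier := W\<rparr>)" for W
    using exceptional_maximal_subgroup_eq[OF M KM N _ min] that by blast
  then show ?thesis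
    using V \<open>K \<noteq> V\<close> by (intro ex1I[of _ V]) auto
qed

end
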